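(* Let $D$ be an infinite countable set, let $\alpha:D\to(0,\infty)$ have limit infinity at infinity, and let $(X_d,\rho_d)$, $d\in D$, be $\infty$-pseudo-metric spaces of finite asymptotic dimension. If there is $c>0$ such that each $X_d$ is $c$-discrete, then the reduced product $(\times_{d\in D}X_d,\rho_\alpha)$ has Asymptotic Property C.
   Context: An $\infty$-pseudo-metric space is a set $X$ with $d:X\times X\to[0,\infty]$ such that $d(x,x)=0$, $d(x,y)=d(y,x)$, and $d(x,y)\le d(x,z)+d(z,y)$ whenever $d(x,z),d(z,y)<\infty$. $B(x,r)=\{y: d(x,y)<r\}$. A space is $c$-discrete if $d(x,y)\ge c$ for all $x\neq y$. A function $\alpha:D\to(0,\infty)$ has limit infinity at infinity if for each $M>0$ there is a finite $E\subset D$ with $\alpha(d)>M$ for all $d\in D\setminus E$. The reduced product $(\times_{d\in D}X_d,\rho_\alpha)$ is the full cartesian product $\prod_{d\in D}X_d$ with the $\infty$-pseudo-metric $\rho_\alpha(u,v)=\sum_{d\in D}\alpha(d)\cdot\rho_d(u(d),v(d))$. Asymptotic dimension: $\mathrm{asdim}(X)\le n$ if for every real $r>0$ there are subsets $X_0,\dots,X_n$ covering $X$ such that each $X_i$ is the union of a uniformly bounded family of sets (diameters at most some $S$) that is $r$-disjoint (points belonging to different members are at distance at least $r$). It is finite if $\mathrm{asdim}(X)\le n$ for some integer $n\ge0$. Scale-$r$-dimension $0$: for $A\subset X$ and $r>0$, a scale-$r$-chain in $A$ is a finite sequence $x_0,\dots,x_k$ of points of $A$ with $B(x_i,r)\cap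 B(x_{i+1},r)\neq\emptyset$ for $0\le i<k$ (balls in $X$). The scale-$r$-component of $x\in A$ is the set of points of $A$ that can be joined to $x$ by a scale-$r$-chain in $A$. $A$ is of scale-$r$-dimension $0$ if the supremum of the diameters of its scale-$r$-components is finite (the diameter of $\emptyset$ is $0$). $X$ has Asymptotic Property C if for each sequence $\{r_i\}_{i\ge1}$ of positive real numbers there are a natural number $n$ and a decomposition $X=\bigcup_{i=1}^n X_i$ such that each $X_i$ is of scale-$r_i$-dimension $0$. *)

theory Defs
  imports "HOL-Analysis.Analysis"
begin

text \<open>
  A space is a carrier set together with a distance function taking values in
  \<^typ>\<open>ennreal\<close>. Only the values on the carrier matter. A family of spaces indexed by
  \<open>d \<in> D\<close> is a family of carriers in a common ambient type.
\<close>

definition inf_pseudo_metric :: "'a set \<Rightarrow> ('a \<Rightarrow> 'a \<Rightarrow> ennreal) \<Rightarrow> bool" where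
  "inf_pseudo_metric X \<rho> \<longleftrightarrow>
     (\<forall>x\<in>X. \<rho> x x = 0) \<and>
     (\<forall>x\<in>X. \<forall>y\<in>X. \<rho> x y = \<rho> y x) \<and>
     (\<forall>x\<in>X. \<forall>y\<in>X. \<forall>z\<in>X. \<rho> x z < \<infinity> \<and> \<rho> z y < \<infinity> \<longrightarrow> \<rho> x y \<le> \<rho> x z + \<rho> z y)"

definition inf_ball :: "'a set \<Rightarrow> ('a \<Rightarrow> 'a \<Rightarrow> ennreal) \<Rightarrow> 'a \<Rightarrow> real \<Rightarrow> 'a set" where
  "inf_ball X \<rho> x r = {y \<in> X. \<rho> x y < ennreal r}"

definition discrete_at_scale :: "real \<Rightarrow> 'a set \<Rightarrow> ('a \<Rightarrow> 'a \<Rightarrow> ennreal) \<Rightarrow> bool" where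
  "discrete_at_scale c X \<rho> \<longleftrightarrow> (\<forall>x\<in>X. \<forall>y\<in>X. x \<noteq> y \<longrightarrow> ennreal c \<le> \<rho> x y)"

text \<open>The supremum is taken in \<^typ>\<open>ennreal\<close>, so the empty set has diameter \<open>0\<close>.\<close>

definition inf_diam :: "('a \<Rightarrow> 'a \<Rightarrow> ennreal) \<Rightarrow> 'a set \<Rightarrow> ennreal" where
  "inf_diam \<rho> A = (SUP x\<in>A. SUP y\<in>A. \<rho> x y)"

definition limit_infinity_at_infinity :: "'d set \<Rightarrow> ('d \<Rightarrow> real) \<Rightarrow> bool" where
  "limit_infinity_at_infinity D \<alpha> \<longleftrightarrow>
     (\<forall>M>0. \<exists>E. finite E \<and> E \<subseteq> D \<and> (\<forall>d\<in>D - E. \<alpha> d > M))"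

text \<open>
  The full cartesian product is \<open>Pi\<^sub>E D X\<close>, whose elements are extensional functions (fixed to
  \<^const>\<open>undefined\<close> outside \<open>D\<close>).
\<close>

definition reduced_dist ::
    "'d set \<Rightarrow> ('d \<Rightarrow> real) \<Rightarrow> ('d \<Rightarrow> 'a \<Rightarrow> 'a \<Rightarrow> ennreal) \<Rightarrow> ('d \<Rightarrow> 'a) \<Rightarrow> ('d \<Rightarrow> 'a) \<Rightarrow> ennreal" where
  "reduced_dist D \<alpha> \<rho> u v = (\<Sum>\<^sub>\<infinity>d\<in>D. ennreal (\<alpha> d) * \<rho> d (u d) (v d))"

definition uniformly_bounded :: "('a \<Rightarrow> 'a \<Rightarrow> ennreal) \<Rightarrow> 'a set set \<Rightarrow> bool" where
  "uniformly_bounded \<rho> \<U> \<longleftrightarrow> (\<exists>S::real. \<forall>U\<in>\<U>. inf_diam \<rho> U \<le> ennreal S)"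

definition scale_disjoint :: "real \<Rightarrow> ('a \<Rightarrow> 'a \<Rightarrow> ennreal) \<Rightarrow> 'a set set \<Rightarrow> bool" where
  "scale_disjoint r \<rho> \<U> \<longleftrightarrow>
     (\<forall>U\<in>\<U>. \<forall>V\<in>\<U>. U \<noteq> V \<longrightarrow> (\<forall>x\<in>U. \<forall>y\<in>V. ennreal r \<le> \<rho> x y))"

definition asdim_le :: "'a set \<Rightarrow> ('a \<Rightarrow> 'a \<Rightarrow> ennreal) \<Rightarrow> nat \<Rightarrow> bool" where
  "asdim_le X \<rho> n \<longleftrightarrow>
     (\<forall>r>0. \<exists>Y :: nat \<Rightarrow> 'a set.
        (\<forall>i\<in>{0..n}. Y i \<subseteq> X) \<and> X = (\<Union>i\<in>{0..n}. Y i) \<and>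
        (\<forall>i\<in>{0..n}. \<exists>\<U>. Y i = \<Union>\<U> \<and> uniformly_bounded \<rho> \<U> \<and> scale_disjoint r \<rho> \<U>))"

definition finite_asdim :: "'a set \<Rightarrow> ('a \<Rightarrow> 'a \<Rightarrow> ennreal) \<Rightarrow> bool" where
  "finite_asdim X \<rho> \<longleftrightarrow> (\<exists>n. asdim_le X \<rho> n)"

text \<open>The chain \<open>x\<^sub>0, \<dots>, x\<^sub>k\<close> is the nonempty list \<open>xs\<close> of length \<open>k + 1\<close>.\<close>

definition scale_chain ::
    "'a set \<Rightarrow> ('a \<Rightarrow> 'a \<Rightarrow> ennreal) \<Rightarrow> real \<Rightarrow> 'a set \<Rightarrow> 'a list \<Rightarrow> bool" where
  "scale_chain X \<rho> r A xs \<longleftrightarrow>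
     xs \<noteq> [] \<and> set xs \<subseteq> A \<and>
     (\<forall>i. Suc i < length xs \<longrightarrow> inf_ball X \<rho> (xs ! i) r \<inter> inf_ball X \<rho> (xs ! Suc i) r \<noteq> {})"

definition scale_component ::
    "'a set \<Rightarrow> ('a \<Rightarrow> 'a \<Rightarrow> ennreal) \<Rightarrow> real \<Rightarrow> 'a set \<Rightarrow> 'a \<Rightarrow> 'a set" where
  "scale_component X \<rho> r A x = {y \<in> A. \<exists>xs. scale_chain X \<rho> r A xs \<and> hd xs = x \<and> last xs = y}"

definition scale_dim_zero ::
    "'a set \<Rightarrow> ('a \<Rightarrow> 'a \<Rightarrow> ennreal) \<Rightarrow> real \<Rightarrow> 'a set \<Rightarrow> bool" where
  "scale_dim_zero X \<rho> r A \<longleftrightarrow> (SUP x\<in>A. inf_diam \<rho> (scale_component X \<rho> r A x)) < \<infinity>"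

definition asymptotic_property_C :: "'a set \<Rightarrow> ('a \<Rightarrow> 'a \<Rightarrow> ennreal) \<Rightarrow> bool" where
  "asymptotic_property_C X \<rho> \<longleftrightarrow>
     (\<forall>r :: nat \<Rightarrow> real. (\<forall>i\<ge>1. r i > 0) \<longrightarrow>
        (\<exists>n. \<exists>Y :: nat \<Rightarrow> 'a set.
           X = (\<Union>i\<in>{1..n}. Y i) \<and> (\<forall>i\<in>{1..n}. scale_dim_zero X \<rho> (r i) (Y i))))"

lemma inf_pseudo_metric_triangle:
  assumes "inf_pseudo_metric X \<rho>" "x \<in> X" "y \<in> X" "z \<in> X"
  shows "\<rho> x y \<le> \<rho> x z + \<rho> z y"
proof (cases "\<rho> x z < \<infinity> \<and> \<rho> z y < \<infinity>")
  case True
  with assms show ?thesis unfolding inf_pseudo_metric_def by blast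
next
  case False
  then have "\<rho> x z = top \<or> \<rho> z y = top" by (auto simp: less_top[symmetric])
  then show ?thesis by auto
qed

lemma inf_pseudo_metric_reduced_product:
  assumes "\<And>d. d \<in> D \<Longrightarrow> inf_pseudo_metric (X d) (\<rho> d)"
  shows "inf_pseudo_metric (Pi\<^sub>E D X) (reduced_dist D \<alpha> \<rho>)"
  unfolding inf_pseudo_metric_def
proof (intro conjI ballI impI)
  fix u assume "u \<in> Pi\<^sub>E D X"
  then have "\<And>d. d \<in> D \<Longrightarrow> \<rho> d (u d) (u d) = 0"
    using assms unfolding inf_pseudo_metric_def by (meson PiE_mem)
  then show "reduced_dist D \<alpha> \<rho> u u = 0"
    unfolding reduced_dist_def by (intro infsum_0) auto
next
  fix u v assume "u \<in> Pi\<^sub>E D X" "v \<in> Pi\<^sub>E D X"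
  then have "\<And>d. d \<in> D \<Longrightarrow> \<rho> d (u d) (v d) = \<rho> d (v d) (u d)"
    using assms unfolding inf_pseudo_metric_def by (meson PiE_mem)
  then show "reduced_dist D \<alpha> \<rho> u v = reduced_dist D \<alpha> \<rho> v u"
    unfolding reduced_dist_def by (intro infsum_cong) auto
next
  fix u v w assume *: "u \<in> Pi\<^sub>E D X" "v \<in> Pi\<^sub>E D X" "w \<in> Pi\<^sub>E D X"
  let ?f = "\<lambda>u v d. ennreal (\<alpha> d) * \<rho> d (u d) (v d)"
  have "(\<Sum>\<^sub>\<infinity>d\<in>D. ?f u v d) \<le> (\<Sum>\<^sub>\<infinity>d\<in>D. ?f u w d + ?f w v d)"
  proof (rule infsum_mono)
    fix d assume "d \<in> D"
    then have "\<rho> d (u d) (v d) \<le> \<rho> d (u d) (w d) + \<rho> d (w d) (v d)"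
      using * by (intro inf_pseudo_metric_triangle[OF assms]) auto
    then show "?f u v d \<le> ?f u w d + ?f w v d"
      by (metis distrib_left mult_left_mono zero_le)
  qed (auto intro: nonneg_summable_on_complete)
  also have "\<dots> = (\<Sum>\<^sub>\<infinity>d\<in>D. ?f u w d) + (\<Sum>\<^sub>\<infinity>d\<in>D. ?f w v d)"
    by (intro infsum_add nonneg_summable_on_complete) auto
  finally show "reduced_dist D \<alpha> \<rho> u v \<le> reduced_dist D \<alpha> \<rho> u w + reduced_dist D \<alpha> \<rho> w v"
    unfolding reduced_dist_def .
qed

end

theory Submission
  imports Defs
begin

text \<open>
  Since the factors are \<open>c\<close>-discrete, only finitely many coordinates can change along a chain of a
  given scale. Let \<open>D\<^sub>1\<close> be the coordinates that can change at scale \<open>r\<^sub>1\<close>. The product over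
  \<open>D\<^sub>1\<close> has finite asymptotic dimension, so it is covered by \<open>q\<close> families at every scale. We use
  \<open>m = 1 + q\<^sup>2\<close> sets. Let \<open>s\<close> bound the doubles of the first \<open>m\<close> scales, and let \<open>W\<close> be the
  coordinates outside \<open>D\<^sub>1\<close> that can change at scale \<open>s\<close>. The product over \<open>W\<close> is covered at scale
  \<open>s\<close> by \<open>N\<close> families, where \<open>N\<close> may be much larger than \<open>m\<close>; let \<open>j(x) < N\<close> be the colour of \<open>x\<close>.

  By a coarse version of Kolmogorov's trick there are \<open>N + q\<close> bounded, \<open>2r\<^sub>1\<close>-disjoint families
  \<open>G\<^sub>k\<close> in the product over \<open>D\<^sub>1\<close> such that every set of a prescribed size lies in a member of \<open>G\<^sub>k\<close>
  for all but fewer than \<open>q\<close> of the \<open>k\<close>. The first set of the decomposition is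
  \<open>{x. x \<in> \<Union>G\<^bsub>j(x)\<^esub>}\<close>, as \<open>j(x)\<close> is constant along chains of scale \<open>r\<^sub>1\<close>. On the complement,
  cover the product over \<open>D\<^sub>1\<close> by \<open>q\<close> families at scale \<open>s\<close>. Each member meets the complements of
  fewer than \<open>q\<close> of the \<open>\<Union>G\<^sub>k\<close>, so \<open>j(x)\<close> is determined by the member containing \<open>x\<close> and one of
  \<open>q\<close> numbers. Splitting by that number and by the colour of the member gives \<open>q\<^sup>2\<close> sets on which
  chains of scale at most \<open>s / 2\<close> keep \<open>j\<close> fixed, hence stay bounded in both factors.
\<close>

section \<open>Labelled families and scale-\<open>r\<close>-dimension 0\<close>

text \<open>
  A bounded, \<open>r\<close>-disjoint family with union \<open>Y\<close> is encoded by a labelling \<open>f\<close> whose level sets in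
  \<open>Y\<close> are the members. Disjointness is stated with \<open>\<sigma> x y \<le> r\<close> instead of \<open><\<close>, which makes the
  \<^typ>\<open>ennreal\<close> arithmetic of enlargements additive.
\<close>

definition clustered :: "('a \<Rightarrow> 'a \<Rightarrow> ennreal) \<Rightarrow> ennreal \<Rightarrow> ennreal \<Rightarrow> 'a set \<Rightarrow> ('a \<Rightarrow> 'b) \<Rightarrow> bool" where
  "clustered \<sigma> r B Y f \<longleftrightarrow>
     (\<forall>x\<in>Y. \<forall>y\<in>Y. (\<sigma> x y \<le> r \<longrightarrow> f x = f y) \<and> (f x = f y \<longrightarrow> \<sigma> x y \<le> B))"

text \<open>Asymptotic dimension below \<open>q\<close>, with one colour per point, so that the
  \<open>q\<close> sets are disjoint. Labels are compared only within a colour, so one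
  \<open>f\<close> serves all colours.\<close>

definition colourable :: "'a set \<Rightarrow> ('a \<Rightarrow> 'a \<Rightarrow> ennreal) \<Rightarrow> nat \<Rightarrow> bool" where
  "colourable P \<sigma> q \<longleftrightarrow> (\<forall>r<top. \<exists>(col :: 'a \<Rightarrow> nat) (f :: 'a \<Rightarrow> 'a set) B. B < top \<and>
     (\<forall>x\<in>P. col x < q) \<and> (\<forall>i. clustered \<sigma> r B {x\<in>P. col x = i} f))"

text \<open>A Lebesgue number condition at the single point \<open>a\<close>; it is pointwise so
  that the families failing it at \<open>a\<close> can be counted.\<close>

definition deep_in :: "'a set \<Rightarrow> ('a \<Rightarrow> 'a \<Rightarrow> ennreal) \<Rightarrow> ennreal \<Rightarrow> 'a set \<Rightarrow> ('a \<Rightarrow> 'b) \<Rightarrow> 'a \<Rightarrow> bool" where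
  "deep_in P \<sigma> S G g a \<longleftrightarrow> (\<forall>b\<in>P. \<sigma> a b \<le> S \<longrightarrow> b \<in> G \<and> g b = g a)"

lemma clusteredD:
  assumes "clustered \<sigma> r B Y f" "x \<in> Y" "y \<in> Y"
  shows "\<sigma> x y \<le> r \<Longrightarrow> f x = f y" "f x = f y \<Longrightarrow> \<sigma> x y \<le> B"
  using assms unfolding clustered_def by blast+

lemma clustered_mono:
  assumes "clustered \<sigma> r B Y f" "r' \<le> r" "B \<le> B'"
  shows "clustered \<sigma> r' B' Y f"
  using assms unfolding clustered_def by (meson order_trans)

text \<open>Centres of overlapping \<open>r\<close>-balls are at distance at most
  \<open>2 * r\<close>, so the label is constant along a chain. Each component lies in one level
  set, and \<open>B\<close> bounds them all.\<close>

lemma scale_dim_zero_clustered: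
  assumes pm: "inf_pseudo_metric X \<rho>" and "Y \<subseteq> X" and "r > 0" and "B < top"
    and cl: "clustered \<rho> (ennreal (2 * r)) B Y f"
  shows "scale_dim_zero X \<rho> r Y"
proof -
  have step: "f x = f y"
    if "x \<in> Y" "y \<in> Y" and ne: "inf_ball X \<rho> x r \<inter> inf_ball X \<rho> y r \<noteq> {}" for x y
  proof -
    obtain z where z: "z \<in> X" "\<rho> x z < ennreal r" "\<rho> y z < ennreal r"
      using ne unfolding inf_ball_def by auto
    have xy: "x \<in> X" "y \<in> X" using that \<open>Y \<subseteq> X\<close> by auto
    have "\<rho> x y \<le> \<rho> x z + \<rho> z y"
      using inf_pseudo_metric_triangle[OF pm] xy z by blast
    also have "\<rho> z y = \<rho> y z" using pm xy z unfolding inf_pseudo_metric_def by blast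
    also have "\<rho> x z + \<rho> y z \<le> ennreal r + ennreal r" using z by (intro add_mono) auto
    also have "\<dots> = ennreal (2 * r)" using \<open>r > 0\<close> by (simp flip: ennreal_plus)
    finally show ?thesis using clusteredD(1)[OF cl] that by blast
  qed
  have chain: "f (last xs) = f (hd xs)" if c: "scale_chain X \<rho> r Y xs" for xs
  proof -
    have "i < length xs \<Longrightarrow> f (xs ! i) = f (xs ! 0)" for i
    proof (induction i)
      case (Suc i)
      then have "f (xs ! i) = f (xs ! Suc i)"
        using c unfolding scale_chain_def by (intro step) (auto simp: subset_iff)
      with Suc show ?case by simp
    qed simp
    from this[of "length xs - 1"] show ?thesis
      using c unfolding scale_chain_def by (simp add: last_conv_nth hd_conv_nth)
  qed
  have comp: "y \<in> Y \<and> f y = f x" if "y \<in> scale_component X \<rho> r Y x" for x y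
    using that chain unfolding scale_component_def by auto
  have "inf_diam \<rho> (scale_component X \<rho> r Y x) \<le> B" for x
    unfolding inf_diam_def
  proof (intro SUP_least)
    fix y z assume "y \<in> scale_component X \<rho> r Y x" "z \<in> scale_component X \<rho> r Y x"
    with comp show "\<rho> y z \<le> B" by (intro clusteredD(2)[OF cl]) metis+
  qed
  then have "(SUP x\<in>Y. inf_diam \<rho> (scale_component X \<rho> r Y x)) \<le> B"
    by (intro SUP_least)
  with \<open>B < top\<close> show ?thesis unfolding scale_dim_zero_def by (simp add: le_less_trans)
qed

section \<open>Colourings of the factors and of finite products\<close>

lemma asdim_le_imp_colourable:
  assumes "asdim_le X \<rho> n"
  shows "colourable X \<rho> (Suc n)"
  unfolding colourable_def
proof (intro allI impI)
  fix r :: ennreal assume "r < top"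
  then obtain r' where r': "r = ennreal r'" "r' \<ge> 0" by (cases r) auto
  \<comment> \<open>Disjointness at scale \<open>r'\<close> would still allow distance exactly
    \<open>r\<close>; the extra 1 excludes it.\<close>
  have lt: "r < ennreal (r' + 1)" using r' by (simp add: ennreal_less_iff)
  obtain Y where Y: "X = (\<Union>i\<in>{0..n}. Y i)"
    "\<And>i. i \<in> {0..n} \<Longrightarrow> \<exists>\<U>. Y i = \<Union>\<U> \<and> uniformly_bounded \<rho> \<U> \<and> scale_disjoint (r' + 1) \<rho> \<U>"
    using assms r' unfolding asdim_le_def by (auto dest!: spec[of _ "r' + 1"])
  obtain \<U> :: "nat \<Rightarrow> 'a set set" where U: "\<And>i. i \<in> {0..n} \<Longrightarrow>
      Y i = \<Union>(\<U> i) \<and> uniformly_bounded \<rho> (\<U> i) \<and> scale_disjoint (r' + 1) \<rho> (\<U> i)"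
    using Y(2) by metis
  obtain S where S: "\<And>i V. i \<in> {0..n} \<Longrightarrow> V \<in> \<U> i \<Longrightarrow> inf_diam \<rho> V \<le> ennreal (S i)"
    using U unfolding uniformly_bounded_def by metis
  obtain col where col: "\<And>x. x \<in> X \<Longrightarrow> col x \<in> {0..n} \<and> x \<in> Y (col x)"
    using Y(1) by (metis UN_E)
  obtain f :: "'a \<Rightarrow> 'a set" where f: "\<And>x. x \<in> X \<Longrightarrow> f x \<in> \<U> (col x) \<and> x \<in> f x"
  proof -
    have "\<forall>x\<in>X. \<exists>V. V \<in> \<U> (col x) \<and> x \<in> V" using col U by blast
    then show thesis using that by (auto simp: bchoice_iff)
  qed
  let ?B = "\<Sum>i\<in>{0..n}. ennreal (S i)"
  have B: "?B < top" by (simp add: less_top[symmetric])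
  have "clustered \<rho> r ?B {x\<in>X. col x = i} f" for i
    unfolding clustered_def
  proof (intro ballI conjI impI)
    fix x y assume xy: "x \<in> {x\<in>X. col x = i}" "y \<in> {x\<in>X. col x = i}"
    then have i: "i \<in> {0..n}" using col by auto
    { assume "\<rho> x y \<le> r"
      then have "\<not> ennreal (r' + 1) \<le> \<rho> x y" using lt by auto
      moreover have "f x \<in> \<U> i" "x \<in> f x" "f y \<in> \<U> i" "y \<in> f y" using f[of x] f[of y] xy by auto
      moreover have "scale_disjoint (r' + 1) \<rho> (\<U> i)" using U[OF i] by simp
      ultimately show "f x = f y" unfolding scale_disjoint_def by blast }
    { assume eq: "f x = f y"
      have "\<rho> x y \<le> inf_diam \<rho> (f x)"
        unfolding inf_diam_def using f[of x] f[of y] xy eq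
        by (intro SUP_upper2[of x] SUP_upper2[of y]) auto
      also have "\<dots> \<le> ennreal (S i)" using S[OF i] f xy by auto
      also have "\<dots> \<le> ?B" using i by (intro member_le_sum) auto
      finally show "\<rho> x y \<le> ?B" . }
  qed
  moreover have "\<forall>x\<in>X. col x < Suc n" using col by (simp add: less_Suc_eq_le)
  ultimately show "\<exists>(col :: 'a \<Rightarrow> nat) (f :: 'a \<Rightarrow> 'a set) B. B < top \<and>
     (\<forall>x\<in>X. col x < Suc n) \<and> (\<forall>i. clustered \<rho> r B {x\<in>X. col x = i} f)"
    using B by blast
qed

text \<open>Colours and labels are tuples of those of the factors, so the number of colours does not
  depend on \<open>r\<close>. \<open>P\<close> stays the full product: \<sigma> ignores coordinates
  outside \<open>E\<close>, and the last conjunct says that the colours do too.\<close>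

lemma product_colouring:
  fixes D :: "'d set" and X :: "'d \<Rightarrow> 'a set"
  assumes "finite E" and "E \<subseteq> D" and pos: "\<And>d. d \<in> E \<Longrightarrow> \<alpha> d > 0"
    and "\<And>d. d \<in> E \<Longrightarrow> colourable (X d) (\<rho> d) (n d)"
  defines "P \<equiv> Pi\<^sub>E D X"
    and "\<sigma> \<equiv> \<lambda>u v. \<Sum>d\<in>E. ennreal (\<alpha> d) * \<rho> d (u d) (v d)"
  shows "\<exists>q. \<forall>r<top.
    \<exists>(col :: ('d \<Rightarrow> 'a) \<Rightarrow> nat) (f :: ('d \<Rightarrow> 'a) \<Rightarrow> ('d \<Rightarrow> 'a) set) B. B < top \<and>
      (\<forall>x\<in>P. col x < q) \<and> (\<forall>i. clustered \<sigma> r B {x\<in>P. col x = i} f) \<and>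
      (\<forall>u v. (\<forall>d\<in>E. u d = v d) \<longrightarrow> col u = col v)"
proof -
  let ?C = "Pi\<^sub>E E (\<lambda>d. {..<n d})"
  have "finite ?C" using \<open>finite E\<close> by (intro finite_PiE) auto
  then obtain h where h: "bij_betw h ?C {0..<card ?C}" using ex_bij_betw_finite_nat by blast
  show ?thesis
  proof (rule exI[of _ "card ?C"], intro allI impI)
    fix r :: ennreal assume "r < top"
    have "\<forall>d\<in>E. \<exists>(col :: 'a \<Rightarrow> nat) (f :: 'a \<Rightarrow> 'a set) B. B < top \<and>
       (\<forall>x\<in>X d. col x < n d) \<and> (\<forall>i. clustered (\<rho> d) (ennreal (1 / \<alpha> d) * r) B {x\<in>X d. col x = i} f)"
    proof
      fix d assume d: "d \<in> E"
      have "ennreal (1 / \<alpha> d) * r < top" using \<open>r < top\<close> by (simp add: ennreal_mult_less_top)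
      then show "\<exists>(col :: 'a \<Rightarrow> nat) (f :: 'a \<Rightarrow> 'a set) B. B < top \<and>
         (\<forall>x\<in>X d. col x < n d) \<and> (\<forall>i. clustered (\<rho> d) (ennreal (1 / \<alpha> d) * r) B {x\<in>X d. col x = i} f)"
        using assms(4)[OF d] unfolding colourable_def by blast
    qed
    then obtain col f B where *: "\<And>d. d \<in> E \<Longrightarrow> B d < top"
      "\<And>d x. d \<in> E \<Longrightarrow> x \<in> X d \<Longrightarrow> (col d x :: nat) < n d"
      "\<And>d i. d \<in> E \<Longrightarrow> clustered (\<rho> d) (ennreal (1 / \<alpha> d) * r) (B d) {x\<in>X d. col d x = i} (f d :: 'a \<Rightarrow> 'a set)"
      unfolding bchoice_iff by blast
    define c where "c u = h (\<lambda>d\<in>E. col d (u d))" for u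
    \<comment> \<open>The tuple of labels is packed into the set of all points sharing it, to fit
      the label type.\<close>
    define F where "F u = {v :: 'd \<Rightarrow> 'a. \<forall>d\<in>E. f d (v d) = f d (u d)}" for u
    let ?B = "\<Sum>d\<in>E. ennreal (\<alpha> d) * B d"
    have F: "F u = F v \<longleftrightarrow> (\<forall>d\<in>E. f d (u d) = f d (v d))" for u v
    proof
      assume "F u = F v"
      moreover have "u \<in> F u" unfolding F_def by simp
      ultimately show "\<forall>d\<in>E. f d (u d) = f d (v d)" unfolding F_def by simp
    qed (simp add: F_def)
    have mem: "(\<lambda>d\<in>E. col d (u d)) \<in> ?C" if "u \<in> P" for u
      using that *(2) \<open>E \<subseteq> D\<close> unfolding P_def by (auto simp: PiE_iff)
    have ceq: "col d (u d) = col d (v d)" if "u \<in> P" "v \<in> P" "c u = c v" "d \<in> E" for u v d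
    proof -
      have "(\<lambda>d\<in>E. col d (u d)) = (\<lambda>d\<in>E. col d (v d))"
        using inj_onD[OF bij_betw_imp_inj_on[OF h] _ mem[OF that(1)] mem[OF that(2)]] that(3)
        unfolding c_def by simp
      from fun_cong[OF this, of d] show ?thesis using that by simp
    qed
    have 1: "?B < top"
      using * \<open>finite E\<close> by (auto simp: less_top[symmetric] ennreal_mult_eq_top_iff)
    have 2: "c x < card ?C" if "x \<in> P" for x
      using bij_betwE[OF h] mem[OF that] unfolding c_def by auto
    have 3: "clustered \<sigma> r ?B {x\<in>P. c x = i} F" for i
      unfolding clustered_def
    proof (intro ballI conjI impI)
      fix u v assume uv: "u \<in> {x\<in>P. c x = i}" "v \<in> {x\<in>P. c x = i}"
      have mem': "u d \<in> {x\<in>X d. col d x = col d (u d)}" "v d \<in> {x\<in>X d. col d x = col d (u d)}"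
        if "d \<in> E" for d
        using uv that \<open>E \<subseteq> D\<close> ceq[of u v d] unfolding P_def by (auto simp: PiE_iff)
      { assume le: "\<sigma> u v \<le> r"
        have "f d (u d) = f d (v d)" if "d \<in> E" for d
        proof (rule clusteredD(1)[OF *(3)[OF that] mem'[OF that]])
          have "ennreal (\<alpha> d) * \<rho> d (u d) (v d) \<le> \<sigma> u v"
            unfolding \<sigma>_def using that \<open>finite E\<close>
            by (intro member_le_sum[where f = "\<lambda>d. ennreal (\<alpha> d) * \<rho> d (u d) (v d)"]) auto
          with le have "ennreal (1 / \<alpha> d) * (ennreal (\<alpha> d) * \<rho> d (u d) (v d)) \<le> ennreal (1 / \<alpha> d) * r"
            by (intro mult_left_mono) auto
          moreover have "ennreal (1 / \<alpha> d) * ennreal (\<alpha> d) = 1"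
            using pos[OF that] by (simp flip: ennreal_mult)
          ultimately show "\<rho> d (u d) (v d) \<le> ennreal (1 / \<alpha> d) * r"
            by (simp flip: mult.assoc)
        qed
        then show "F u = F v" using F by blast }
      { assume "F u = F v"
        then have "\<rho> d (u d) (v d) \<le> B d" if "d \<in> E" for d
          using F that clusteredD(2)[OF *(3)[OF that] mem'[OF that]] by blast
        then show "\<sigma> u v \<le> ?B" unfolding \<sigma>_def by (intro sum_mono mult_left_mono) auto }
    qed
    have 4: "c u = c v" if "\<forall>d\<in>E. u d = v d" for u v
    proof -
      have "(\<lambda>d\<in>E. col d (u d)) = (\<lambda>d\<in>E. col d (v d))" using that by auto
      then show ?thesis unfolding c_def by simp
    qed
    show "\<exists>(col :: ('d \<Rightarrow> 'a) \<Rightarrow> nat) (f :: ('d \<Rightarrow> 'a) \<Rightarrow> ('d \<Rightarrow> 'a) set) B. B < top \<and>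
      (\<forall>x\<in>P. col x < card ?C) \<and> (\<forall>i. clustered \<sigma> r B {x\<in>P. col x = i} f) \<and>
      (\<forall>u v. (\<forall>d\<in>E. u d = v d) \<longrightarrow> col u = col v)"
      using 1 2 3 4 by blast
  qed
qed

section \<open>Thickening and the coarse Kolmogorov trick\<close>

text \<open>The new members are the \<open>S\<close>-neighbourhoods of the old ones, labelled
  through a chosen point \<open>p b\<close> of \<open>H\<close> within \<open>S\<close>. Separation
  uses up \<open>2 * S\<close>; the third \<open>S\<close> is for depth, where the path
  \<open>p b\<close>, \<open>b\<close>, \<open>a\<close>, \<open>p a\<close> has three
  steps.\<close>

lemma thicken:
  fixes \<sigma> :: "'a \<Rightarrow> 'a \<Rightarrow> ennreal" and h :: "'a \<Rightarrow> 'b"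
  assumes pm: "inf_pseudo_metric P \<sigma>" and "H \<subseteq> P"
    and cl: "clustered \<sigma> (r + 3 * S) B H h"
  obtains G and g :: "'a \<Rightarrow> 'b" where "G \<subseteq> P" and "clustered \<sigma> r (B + 2 * S) G g"
    and "\<And>a. a \<in> H \<Longrightarrow> deep_in P \<sigma> S G g a"
proof -
  have tri: "\<sigma> x y \<le> a + b" if "\<sigma> x z \<le> a" "\<sigma> z y \<le> b" "x \<in> P" "y \<in> P" "z \<in> P" for x y z a b
    using inf_pseudo_metric_triangle[OF pm that(3-5)] add_mono[OF that(1,2)] by (rule order_trans)
  have sym: "\<sigma> x y = \<sigma> y x" if "x \<in> P" "y \<in> P" for x y
    using pm that unfolding inf_pseudo_metric_def by blast
  have refl: "\<sigma> x x = 0" if "x \<in> P" for x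
    using pm that unfolding inf_pseudo_metric_def by blast
  define G where "G = {b\<in>P. \<exists>a\<in>H. \<sigma> a b \<le> S}"
  define p where "p b = (SOME a. a \<in> H \<and> \<sigma> a b \<le> S)" for b
  have p: "p b \<in> H" "p b \<in> P" "b \<in> P" "\<sigma> (p b) b \<le> S" "\<sigma> b (p b) \<le> S" if "b \<in> G" for b
  proof -
    have "\<exists>a. a \<in> H \<and> \<sigma> a b \<le> S" "b \<in> P" using that unfolding G_def by auto
    from someI_ex[OF this(1)] show "p b \<in> H" "p b \<in> P" "b \<in> P" "\<sigma> (p b) b \<le> S" "\<sigma> b (p b) \<le> S"
      using sym \<open>H \<subseteq> P\<close> \<open>b \<in> P\<close> unfolding p_def by fastforce+
  qed
  have eq1: "S + r + S \<le> r + 3 * S" and eq2: "S + S + S = 3 * S" "S + B + S = B + 2 * S"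
  proof -
    have "S + r + S = r + 2 * S" by (simp add: mult_2 mult_2_right algebra_simps)
    also have "\<dots> \<le> r + 3 * S" by (intro add_left_mono mult_right_mono) auto
    finally show "S + r + S \<le> r + 3 * S" .
    show "S + S + S = 3 * S" using distrib_right[of "2::ennreal" 1 S] by (simp add: mult_2)
    show "S + B + S = B + 2 * S" by (simp add: mult_2 mult_2_right algebra_simps)
  qed
  show thesis
  proof (rule that[of G "\<lambda>b. h (p b)"])
    show "G \<subseteq> P" unfolding G_def by auto
    show "clustered \<sigma> r (B + 2 * S) G (\<lambda>b. h (p b))"
      unfolding clustered_def
    proof (intro ballI conjI impI)
      fix x y assume xy: "x \<in> G" "y \<in> G"
      note px = p[OF xy(1)] and py = p[OF xy(2)]
      { assume "\<sigma> x y \<le> r"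
        then have "\<sigma> (p x) y \<le> S + r" using px py by - (rule tri[of _ x]; auto)
        then have "\<sigma> (p x) (p y) \<le> S + r + S" using px py by - (rule tri[of _ y]; auto)
        then show "h (p x) = h (p y)"
          using eq1 px py by (intro clusteredD(1)[OF cl]) (auto intro: order_trans) }
      { assume "h (p x) = h (p y)"
        then have "\<sigma> (p x) (p y) \<le> B" using px py by (intro clusteredD(2)[OF cl]) auto
        then have "\<sigma> x (p y) \<le> S + B" using px py by - (rule tri[of _ "p x"]; auto)
        then have "\<sigma> x y \<le> S + B + S" using px py by - (rule tri[of _ "p y"]; auto)
        then show "\<sigma> x y \<le> B + 2 * S" using eq2 by simp }
    qed
    fix a assume a: "a \<in> H"
    have aP: "a \<in> P" and aG: "a \<in> G" using a \<open>H \<subseteq> P\<close> refl unfolding G_def by force+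
    show "deep_in P \<sigma> S G (\<lambda>b. h (p b)) a"
      unfolding deep_in_def
    proof (intro ballI impI conjI)
      fix b assume b: "b \<in> P" "\<sigma> a b \<le> S"
      then show bG: "b \<in> G" using a unfolding G_def by auto
      note pa = p[OF aG] and pb = p[OF bG]
      have "\<sigma> b a \<le> S" using b sym[OF aP b(1)] by simp
      then have "\<sigma> (p b) a \<le> S + S" using pb b aP by - (rule tri[of _ b]; auto)
      then have "\<sigma> (p b) (p a) \<le> S + S + S" using pb pa aP by - (rule tri[of _ a]; auto)
      then have "\<sigma> (p b) (p a) \<le> r + 3 * S" unfolding eq2 by (simp add: add_increasing)
      then show "h (p b) = h (p a)" using pa pb by (intro clusteredD(1)[OF cl]) auto
    qed
  qed
qed

text \<open>
  The induction step enlarges the margin \<open>S\<close> and adds a family that repairs the points with the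
  maximal number \<open>q - 1\<close> of bad indices. Nearby points of this kind have the same bad indices and,
  as \<open>M \<ge> q\<close>, share a member for some good index, so the new family is disjoint and bounded.
\<close>

lemma kolmogorov_families:
  fixes \<sigma> :: "'a \<Rightarrow> 'a \<Rightarrow> ennreal"
  assumes pm: "inf_pseudo_metric P \<sigma>" and colourable: "colourable P \<sigma> q"
    and "q \<le> M" and "r < top" and "S < top"
  shows "\<exists>G (g :: nat \<Rightarrow> 'a \<Rightarrow> 'a set) B. B < top \<and> (\<forall>k<M. G k \<subseteq> P \<and> clustered \<sigma> r B (G k) (g k)) \<and>
    (\<forall>a\<in>P. card {k. k < M \<and> \<not> deep_in P \<sigma> S (G k) (g k) a} < q)"
  using assms(3-)
proof (induction M arbitrary: r S rule: nat_induct_at_least)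
  case base
  then have "r + 3 * S < top" by (simp add: ennreal_mult_less_top)
  then obtain col and f :: "'a \<Rightarrow> 'a set" and B where
    *: "B < top" "\<And>x. x \<in> P \<Longrightarrow> col x < q"
       "\<And>i. clustered \<sigma> (r + 3 * S) B {x\<in>P. col x = i} f"
    using colourable unfolding colourable_def by meson
  have "\<exists>G g. G \<subseteq> P \<and> clustered \<sigma> r (B + 2 * S) G (g :: 'a \<Rightarrow> 'a set) \<and>
      (\<forall>a. a \<in> P \<and> col a = i \<longrightarrow> deep_in P \<sigma> S G g a)" for i
    by (rule thicken[OF pm _ *(3)[of i]]) blast+
  then obtain G and g :: "nat \<Rightarrow> 'a \<Rightarrow> 'a set" where
    G: "\<And>i. G i \<subseteq> P" "\<And>i. clustered \<sigma> r (B + 2 * S) (G i) (g i)"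
       "\<And>i a. a \<in> P \<Longrightarrow> col a = i \<Longrightarrow> deep_in P \<sigma> S (G i) (g i) a"
    by metis
  \<comment> \<open>The index \<open>col a\<close> is never bad at \<open>a\<close>, which leaves at
    most \<open>q - 1\<close> bad ones.\<close>
  have "card {k. k < q \<and> \<not> deep_in P \<sigma> S (G k) (g k) a} < q" if "a \<in> P" for a
  proof -
    have "{k. k < q \<and> \<not> deep_in P \<sigma> S (G k) (g k) a} \<subset> {..<q}"
      using G(3)[OF that refl] *(2)[OF that] by auto
    from psubset_card_mono[OF _ this] show ?thesis by simp
  qed
  moreover have "B + 2 * S < top" using *(1) base by (simp add: ennreal_mult_less_top)
  ultimately show ?case using G(1,2) by blast
next
  case (Suc M)
  have tri: "\<sigma> x y \<le> a + b" if "\<sigma> x z \<le> a" "\<sigma> z y \<le> b" "x \<in> P" "y \<in> P" "z \<in> P" for x y z a b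
    using inf_pseudo_metric_triangle[OF pm that(3-5)] add_mono[OF that(1,2)] by (rule order_trans)
  have refl: "\<sigma> x x = 0" if "x \<in> P" for x
    using pm that unfolding inf_pseudo_metric_def by blast
  \<comment> \<open>This is the separation that \<open>thicken\<close> asks of \<open>H\<close>. An
    index good at \<open>a\<close> with margin \<open>?\<delta> + S\<close> stays good with margin
    \<open>S\<close> at all points within \<open>?\<delta>\<close> of \<open>a\<close>.\<close>
  let ?\<delta> = "r + 3 * S"
  have "?\<delta> + S < top" using Suc.prems by (simp add: ennreal_mult_less_top)
  from Suc.IH[OF \<open>r < top\<close> this] obtain G and g :: "nat \<Rightarrow> 'a \<Rightarrow> 'a set" and B where
    *: "B < top" "\<And>k. k < M \<Longrightarrow> G k \<subseteq> P" "\<And>k. k < M \<Longrightarrow> clustered \<sigma> r B (G k) (g k)"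
      "\<And>a. a \<in> P \<Longrightarrow> card {k. k < M \<and> \<not> deep_in P \<sigma> (?\<delta> + S) (G k) (g k) a} < q"
    by blast
  define bad where "bad a = {k. k < M \<and> \<not> deep_in P \<sigma> S (G k) (g k) a}" for a
  define worse where "worse a = {k. k < M \<and> \<not> deep_in P \<sigma> (?\<delta> + S) (G k) (g k) a}" for a
  have fin: "finite (bad a)" "finite (worse a)" for a unfolding bad_def worse_def by auto
  have worse: "card (worse a) < q" if "a \<in> P" for a using *(4)[OF that] unfolding worse_def .
  have deep_trans: "deep_in P \<sigma> S (G k) (g k) b" "g k b = g k a"
    if "deep_in P \<sigma> (?\<delta> + S) (G k) (g k) a" "a \<in> P" "b \<in> P" "\<sigma> a b \<le> ?\<delta>" for a b k
  proof -
    have D: "x \<in> G k \<and> g k x = g k a" if "x \<in> P" "\<sigma> b x \<le> S" for x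
    proof -
      have "\<sigma> a x \<le> ?\<delta> + S" by (rule tri[of _ b]) fact+
      with \<open>deep_in P \<sigma> (?\<delta> + S) (G k) (g k) a\<close> that(1) show ?thesis unfolding deep_in_def by blast
    qed
    from D[of b] show "g k b = g k a" using refl \<open>b \<in> P\<close> by simp
    with D show "deep_in P \<sigma> S (G k) (g k) b" unfolding deep_in_def by auto
  qed
  have bad_worse: "bad b \<subseteq> worse a" if "a \<in> P" "b \<in> P" "\<sigma> a b \<le> ?\<delta>" for a b
    using deep_trans(1)[OF _ that] unfolding bad_def worse_def by blast
  define H where "H = {a\<in>P. Suc (card (bad a)) = q}"
  define h where "h a = {c\<in>H. bad c = bad a \<and> (\<forall>k<M. k \<notin> bad a \<longrightarrow> g k c = g k a)}" for a
  have clH: "clustered \<sigma> ?\<delta> B H h"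
    unfolding clustered_def
  proof (intro ballI conjI impI)
    fix a b assume ab: "a \<in> H" "b \<in> H"
    then have P: "a \<in> P" "b \<in> P" unfolding H_def by auto
    { assume le: "\<sigma> a b \<le> ?\<delta>"
      \<comment> \<open>\<open>worse x\<close> has fewer than \<open>q\<close> elements and contains
        the \<open>q - 1\<close> elements of \<open>bad y\<close>, so the two coincide. Using
        \<open>x = a\<close> for both points equates their bad sets.\<close>
      have sat: "bad y = worse x" if "x \<in> P" "y \<in> H" "\<sigma> x y \<le> ?\<delta>" for x y
      proof (rule card_seteq[OF fin(2)])
        have "y \<in> P" "Suc (card (bad y)) = q" using that(2) unfolding H_def by auto
        then show "bad y \<subseteq> worse x" "card (worse x) \<le> card (bad y)"
          using bad_worse[OF that(1) _ that(3)] worse[OF that(1)] by auto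
      qed
      have "bad a = worse a" "bad b = worse a"
        using sat[of a a] sat[of a b] P ab le refl by auto
      moreover have "g k b = g k a" if "k < M" "k \<notin> bad a" for k
        using deep_trans(2)[OF _ P le] that \<open>bad a = worse a\<close> unfolding worse_def by auto
      ultimately show "h a = h b" unfolding h_def by auto }
    { assume "h a = h b"
      moreover have "a \<in> h a" using ab unfolding h_def by auto
      ultimately have eq: "bad a = bad b" "\<And>k. k < M \<Longrightarrow> k \<notin> bad b \<Longrightarrow> g k a = g k b"
        unfolding h_def by auto
      \<comment> \<open>Since \<open>q - 1 < M\<close>, some index is good, and the common member
        there bounds the distance.\<close>
      have "card (bad b) < card {..<M}" using ab Suc.hyps unfolding H_def by auto
      then have "\<not> {..<M} \<subseteq> bad b" using fin card_mono[of "bad b" "{..<M}"] by auto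
      then obtain k where k: "k < M" "k \<notin> bad b" by auto
      then have "deep_in P \<sigma> S (G k) (g k) a" "deep_in P \<sigma> S (G k) (g k) b"
        using eq(1) unfolding bad_def by auto
      then have "a \<in> G k" "b \<in> G k"
        using P refl[OF P(1)] refl[OF P(2)] unfolding deep_in_def by auto
      then show "\<sigma> a b \<le> B" using eq(2)[OF k] clusteredD(2)[OF *(3)[OF k(1)]] by blast }
  qed
  obtain G' and g' :: "'a \<Rightarrow> 'a set" where
    G': "G' \<subseteq> P" "clustered \<sigma> r (B + 2 * S) G' g'"
        "\<And>a. a \<in> H \<Longrightarrow> deep_in P \<sigma> S G' g' a"
    by (rule thicken[OF pm _ clH]) (auto simp: H_def)
  have "(if k < M then G k else G') \<subseteq> P \<and>
      clustered \<sigma> r (B + 2 * S) (if k < M then G k else G') (if k < M then g k else g')" for k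
    using *(2,3)[of k] G' clustered_mono[of \<sigma> r B _ _ r "B + 2 * S"] by auto
  moreover have "card {k. k < Suc M \<and> \<not> deep_in P \<sigma> S (if k < M then G k else G') (if k < M then g k else g') a} < q"
    (is "card ?K < q") if "a \<in> P" for a
  proof (cases "a \<in> H")
    case True
    then have "?K \<subseteq> bad a" using G'(3) unfolding bad_def by (auto simp: less_Suc_eq)
    then have "card ?K \<le> card (bad a)" by (intro card_mono fin)
    with True show ?thesis unfolding H_def by auto
  next
    case False
    have "card (bad a) \<le> card (worse a)"
      using bad_worse[of a a] that refl by (intro card_mono fin) auto
    then have lt: "Suc (card (bad a)) < q" using worse[OF that] False that unfolding H_def by auto
    \<comment> \<open>Outside \<open>H\<close> at most \<open>q - 2\<close> indices are bad, so the
      new index \<open>M\<close> may be bad as well.\<close>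
    have "?K \<subseteq> insert M (bad a)" unfolding bad_def by (auto simp: less_Suc_eq)
    then have "card ?K \<le> card (insert M (bad a))" by (intro card_mono) (auto simp: fin)
    also have "\<dots> \<le> Suc (card (bad a))" by (simp add: card_insert_if fin)
    finally show ?thesis using lt by simp
  qed
  moreover have "B + 2 * S < top" using *(1) Suc.prems by (simp add: ennreal_mult_less_top)
  ultimately show ?case
    by (intro exI[of _ "\<lambda>k. if k < M then G k else G'"] exI[of _ "\<lambda>k. if k < M then g k else g'"]
          exI[of _ "B + 2 * S"]) auto
qed

text \<open>Rank is strictly increasing on \<open>J\<close>: for \<open>a < b\<close> in
  \<open>J\<close>, \<open>a\<close> is counted below \<open>b\<close> but not below itself.\<close>

lemma card_below_inj:
  fixes J :: "nat set"
  assumes "finite J" "i \<in> J" "j \<in> J" "card {k\<in>J. k < i} = card {k\<in>J. k < j}"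
  shows "i = j"
proof -
  have lt: "card {k\<in>J. k < a} < card {k\<in>J. k < b}" if "a < b" "a \<in> J" for a b
    using that \<open>finite J\<close> by (intro psubset_card_mono) auto
  show ?thesis using lt[of i j] lt[of j i] assms by (cases i j rule: linorder_cases) auto
qed

theorem corollary7p12:
  fixes D :: "'d set" and \<alpha> :: "'d \<Rightarrow> real"
    and X :: "'d \<Rightarrow> 'a set" and \<rho> :: "'d \<Rightarrow> 'a \<Rightarrow> 'a \<Rightarrow> ennreal" and c :: real
  assumes "infinite D" and "countable D"
    and "\<And>d. d \<in> D \<Longrightarrow> \<alpha> d > 0"
    and "limit_infinity_at_infinity D \<alpha>"
    and "\<And>d. d \<in> D \<Longrightarrow> inf_pseudo_metric (X d) (\<rho> d)"
    and "\<And>d. d \<in> D \<Longrightarrow> finite_asdim (X d) (\<rho> d)"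
    and "c > 0"
    and "\<And>d. d \<in> D \<Longrightarrow> discrete_at_scale c (X d) (\<rho> d)"
  shows "asymptotic_property_C (Pi\<^sub>E D X) (reduced_dist D \<alpha> \<rho>)"
  unfolding asymptotic_property_C_def
proof (intro allI impI)
  fix r :: "nat \<Rightarrow> real" assume r: "\<forall>i\<ge>1. r i > 0"

  \<comment> \<open>Finitely many active coordinates at each scale\<close>
  let ?P = "Pi\<^sub>E D X" and ?R = "reduced_dist D \<alpha> \<rho>"
  define \<sigma> where "\<sigma> E u v = (\<Sum>d\<in>E. ennreal (\<alpha> d) * \<rho> d (u d) (v d))" for E u v
  \<comment> \<open>A change in coordinate \<open>d\<close> costs at least
    \<open>\<alpha> d * c\<close>, so points at distance at most \<open>s\<close> differ only on
    \<open>V s\<close>.\<close>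
  define V where "V s = {d\<in>D. \<alpha> d * c \<le> s}" for s
  have finV: "finite (V s)" for s
  proof -
    \<comment> \<open>The absolute value keeps the threshold positive for every real
      \<open>s\<close>.\<close>
    have "\<bar>s\<bar> / c + 1 > 0" using \<open>c > 0\<close> by (simp add: add_nonneg_pos)
    then obtain E where E: "finite E" "\<forall>d\<in>D - E. \<alpha> d > \<bar>s\<bar> / c + 1"
      using assms(4) unfolding limit_infinity_at_infinity_def by blast
    have "V s \<subseteq> E"
    proof
      fix d assume d: "d \<in> V s"
      then have "\<alpha> d \<le> s / c" using \<open>c > 0\<close> unfolding V_def by (simp add: field_simps)
      also have "\<dots> \<le> \<bar>s\<bar> / c" using \<open>c > 0\<close> by (simp add: divide_right_mono)
      finally show "d \<in> E" using E d unfolding V_def by force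
    qed
    then show ?thesis using E finite_subset by blast
  qed
  have VD: "V s \<subseteq> D" for s unfolding V_def by auto
  have pm: "inf_pseudo_metric ?P ?R" by (intro inf_pseudo_metric_reduced_product assms(5))
  have \<sigma>_le: "\<sigma> E u v \<le> ?R u v" if "finite E" "E \<subseteq> D" for E u v
  proof -
    have "\<sigma> E u v = (\<Sum>\<^sub>\<infinity>d\<in>E. ennreal (\<alpha> d) * \<rho> d (u d) (v d))"
      unfolding \<sigma>_def using that by simp
    also have "\<dots> \<le> ?R u v"
      unfolding reduced_dist_def using that
      by (intro infsum_mono_neutral nonneg_summable_on_complete) auto
    finally show ?thesis .
  qed
  have agree: "u d = v d"
    if "u \<in> ?P" "v \<in> ?P" "?R u v \<le> ennreal s" "d \<in> D - V s" for u v s d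
  proof (rule ccontr)
    assume "u d \<noteq> v d"
    then have "ennreal c \<le> \<rho> d (u d) (v d)"
      using assms(8)[of d] that unfolding discrete_at_scale_def by (auto simp: PiE_iff)
    then have "ennreal (\<alpha> d) * ennreal c \<le> ennreal (\<alpha> d) * \<rho> d (u d) (v d)"
      by (intro mult_left_mono) auto
    also have "\<dots> = \<sigma> {d} u v" unfolding \<sigma>_def by simp
    also have "\<dots> \<le> ?R u v" using that by (intro \<sigma>_le) auto
    also have "\<dots> \<le> ennreal s" by fact
    finally have "ennreal (\<alpha> d * c) \<le> ennreal s"
      using assms(3)[of d] \<open>c > 0\<close> that by (simp add: ennreal_mult)
    moreover have "\<alpha> d * c > 0" using assms(3)[of d] \<open>c > 0\<close> that by simp
    ultimately have "\<alpha> d * c \<le> s" by (metis ennreal_le_iff2 not_less)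
    then show False using that unfolding V_def by auto
  qed
  have R_eq: "?R u v = \<sigma> E u v"
    if "u \<in> ?P" "v \<in> ?P" "finite E" "E \<subseteq> D" "\<And>d. d \<in> D - E \<Longrightarrow> u d = v d" for u v E
  proof -
    have "\<rho> d (u d) (v d) = 0" if "d \<in> D - E" for d
      using that \<open>u \<in> ?P\<close> assms(5)[of d] \<open>d \<in> D - E \<Longrightarrow> u d = v d\<close>
      unfolding inf_pseudo_metric_def by (metis DiffD1 PiE_mem)
    then have "?R u v = (\<Sum>\<^sub>\<infinity>d\<in>E. ennreal (\<alpha> d) * \<rho> d (u d) (v d))"
      unfolding reduced_dist_def using that by (intro infsum_cong_neutral) auto
    then show ?thesis unfolding \<sigma>_def using \<open>finite E\<close> by simp
  qed
  \<comment> \<open>A finite partial sum is the reduced distance for weights that vanish off \<open>E\<close>.\<close>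
  have \<sigma>_pm: "inf_pseudo_metric ?P (\<sigma> E)" if "E \<subseteq> D" "finite E" for E
  proof -
    have "\<sigma> E u v = reduced_dist D (\<lambda>d. if d \<in> E then \<alpha> d else 0) \<rho> u v" for u v
    proof -
      have "reduced_dist D (\<lambda>d. if d \<in> E then \<alpha> d else 0) \<rho> u v =
          (\<Sum>\<^sub>\<infinity>d\<in>E. ennreal (\<alpha> d) * \<rho> d (u d) (v d))"
        unfolding reduced_dist_def using that by (intro infsum_cong_neutral) auto
      then show ?thesis unfolding \<sigma>_def using that by simp
    qed
    then have "\<sigma> E = reduced_dist D (\<lambda>d. if d \<in> E then \<alpha> d else 0) \<rho>" by blast
    then show ?thesis by (simp add: inf_pseudo_metric_reduced_product assms(5))
  qed
  obtain n where n: "\<And>d. d \<in> D \<Longrightarrow> colourable (X d) (\<rho> d) (n d)"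
  proof -
    have "\<forall>d\<in>D. \<exists>n. colourable (X d) (\<rho> d) n"
      using assms(6) asdim_le_imp_colourable unfolding finite_asdim_def by blast
    then show thesis using that unfolding bchoice_iff by blast
  qed

  \<comment> \<open>Choice of the scales and the families\<close>
  define D1 where "D1 = V (2 * r 1)"
  have D1: "finite D1" "D1 \<subseteq> D" unfolding D1_def by (auto simp: finV VD)
  have prod: "\<exists>q. \<forall>s<top.
    \<exists>(col :: ('d \<Rightarrow> 'a) \<Rightarrow> nat) (f :: ('d \<Rightarrow> 'a) \<Rightarrow> ('d \<Rightarrow> 'a) set) B. B < top \<and>
      (\<forall>x\<in>?P. col x < q) \<and> (\<forall>i. clustered (\<sigma> E) s B {x\<in>?P. col x = i} f) \<and>
      (\<forall>u v. (\<forall>d\<in>E. u d = v d) \<longrightarrow> col u = col v)" if "finite E" "E \<subseteq> D" for E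
    unfolding \<sigma>_def[abs_def]
  proof (rule product_colouring[OF that])
    fix d assume "d \<in> E"
    with that show "\<alpha> d > 0" "colourable (X d) (\<rho> d) (n d)" using assms(3) n by auto
  qed
  obtain q where colq: "colourable ?P (\<sigma> D1) q"
    using prod[OF D1] unfolding colourable_def by meson
  \<comment> \<open>One set from the families \<open>G\<close>, and one for each pair of a colour
    and a rank. As \<open>q\<close> depends only on \<open>D1\<close>, \<open>m\<close> is fixed
    before \<open>s\<close>, \<open>W\<close> and \<open>N\<close>.\<close>
  define m where "m = 1 + q * q"
  define s where "s = Max ((\<lambda>i. 2 * r i) ` {1..m})"
  have s: "2 * r i \<le> s" if "i \<in> {1..m}" for i unfolding s_def using that by (intro Max_ge) auto
  \<comment> \<open>Removing \<open>D1\<close> makes \<open>wcol\<close> insensitive to moves inside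
    \<open>D1\<close> and lets the distance split into two sums.\<close>
  define W where "W = V s - D1"
  have W: "finite W" "W \<subseteq> D" "D1 \<inter> W = {}" unfolding W_def by (auto simp: finV VD subset_iff)
    (use VD in auto)
  have D1W: "D1 \<union> W = V s" using s[of 1] unfolding W_def D1_def V_def m_def by auto
  obtain N where N: "\<forall>s<top.
    \<exists>(col :: ('d \<Rightarrow> 'a) \<Rightarrow> nat) (f :: ('d \<Rightarrow> 'a) \<Rightarrow> ('d \<Rightarrow> 'a) set) B. B < top \<and>
      (\<forall>x\<in>?P. col x < N) \<and> (\<forall>i. clustered (\<sigma> W) s B {x\<in>?P. col x = i} f) \<and>
      (\<forall>u v. (\<forall>d\<in>W. u d = v d) \<longrightarrow> col u = col v)"
    using prod[OF W(1,2)] ..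
  obtain wcol and wf :: "('d \<Rightarrow> 'a) \<Rightarrow> ('d \<Rightarrow> 'a) set" and WB where "WB < top \<and>
      (\<forall>x\<in>?P. wcol x < N) \<and> (\<forall>i. clustered (\<sigma> W) (ennreal s) WB {x\<in>?P. wcol x = i} wf) \<and>
      (\<forall>u v. (\<forall>d\<in>W. u d = v d) \<longrightarrow> wcol u = wcol v)"
    using N[THEN spec, THEN mp, OF ennreal_less_top[of s]] by (elim exE) (rule that)
  then have w: "WB < top" "\<And>x. x \<in> ?P \<Longrightarrow> wcol x < N"
    "\<And>i. clustered (\<sigma> W) (ennreal s) WB {x\<in>?P. wcol x = i} wf"
    "\<And>u v. (\<forall>d\<in>W. u d = v d) \<Longrightarrow> wcol u = wcol v"
    by simp_all
  obtain col and f :: "('d \<Rightarrow> 'a) \<Rightarrow> ('d \<Rightarrow> 'a) set" and B where "B < top \<and>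
      (\<forall>x\<in>?P. col x < q) \<and> (\<forall>i. clustered (\<sigma> D1) (ennreal s) B {x\<in>?P. col x = i} f)"
    using colq[unfolded colourable_def, THEN spec, THEN mp, OF ennreal_less_top[of s]]
    by (elim exE) (rule that)
  then have u: "B < top" "\<And>x. x \<in> ?P \<Longrightarrow> col x < q"
    "\<And>i. clustered (\<sigma> D1) (ennreal s) B {x\<in>?P. col x = i} f"
    by simp_all
  \<comment> \<open>The margin \<open>B\<close> bounds the members just chosen, so the member
    containing \<open>a\<close> lies inside \<open>G k\<close> for each good \<open>k\<close>.
    \<open>N + q\<close> families suffice to index by \<open>wcol x < N\<close> and are at least
    \<open>q\<close> in number.\<close>
  obtain G and g :: "nat \<Rightarrow> ('d \<Rightarrow> 'a) \<Rightarrow> ('d \<Rightarrow> 'a) set" and GB where "GB < top \<and>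
      (\<forall>k<N + q. G k \<subseteq> ?P \<and> clustered (\<sigma> D1) (ennreal (2 * r 1)) GB (G k) (g k)) \<and>
      (\<forall>a\<in>?P. card {k. k < N + q \<and> \<not> deep_in ?P (\<sigma> D1) B (G k) (g k) a} < q)"
    using kolmogorov_families[OF \<sigma>_pm[OF D1(2,1)] colq le_add2 ennreal_less_top[of "2 * r 1"] u(1), of N]
    by (elim exE) (rule that)
  then have G: "GB < top"
    "\<And>k. k < N + q \<Longrightarrow> clustered (\<sigma> D1) (ennreal (2 * r 1)) GB (G k) (g k)"
    "\<And>a. a \<in> ?P \<Longrightarrow> card {k. k < N + q \<and> \<not> deep_in ?P (\<sigma> D1) B (G k) (g k) a} < q"
    by simp_all

  \<comment> \<open>The decomposition into \<open>m\<close> sets\<close>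
  \<comment> \<open>\<open>J x\<close> depends only on the member containing \<open>x\<close>, that
    is, on \<open>col x\<close> and \<open>f x\<close>.\<close>
  define J where "J x = {k. k < N + q \<and> (\<exists>y\<in>?P. col y = col x \<and> f y = f x \<and> y \<notin> G k)}" for x
  define idx where "idx x = card {k \<in> J x. k < wcol x}" for x
  have finJ: "finite (J x)" for x unfolding J_def by auto
  have J_card: "card (J x) < q" if "x \<in> ?P" for x
  proof -
    have "\<sigma> D1 x y \<le> B" if "y \<in> ?P" "col y = col x" "f y = f x" for y
      using clusteredD(2)[OF u(3)[of "col x"], of x y] that \<open>x \<in> ?P\<close> by auto
    then have "J x \<subseteq> {k. k < N + q \<and> \<not> deep_in ?P (\<sigma> D1) B (G k) (g k) x}"
      unfolding J_def deep_in_def by blast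
    then have "card (J x) \<le> card {k. k < N + q \<and> \<not> deep_in ?P (\<sigma> D1) B (G k) (g k) x}"
      by (intro card_mono) auto
    with G(3)[OF that] show ?thesis by simp
  qed
  have idx_lt: "idx x < q" if "x \<in> ?P" for x
  proof -
    have "idx x \<le> card (J x)" unfolding idx_def by (intro card_mono finJ) auto
    with J_card[OF that] show ?thesis by simp
  qed
  \<comment> \<open>The pair of \<open>col x\<close> and \<open>idx x\<close> is coded in base
    \<open>q\<close> and shifted by 2, as index 1 is taken; \<open>idx x < q\<close> lets division
    by \<open>q\<close> recover the colour.\<close>
  define Y where "Y i = (if i = 1 then {x\<in>?P. x \<in> G (wcol x)}
    else {x\<in>?P. x \<notin> G (wcol x) \<and> i = 2 + (col x * q + idx x)})" for i
  have YP: "Y i \<subseteq> ?P" for i unfolding Y_def by auto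
  have cover: "?P = (\<Union>i\<in>{1..m}. Y i)"
  proof (intro equalityI subsetI)
    fix x assume x: "x \<in> ?P"
    show "x \<in> (\<Union>i\<in>{1..m}. Y i)"
    proof (cases "x \<in> G (wcol x)")
      case True
      then have "x \<in> Y 1" using x unfolding Y_def by simp
      then show ?thesis unfolding m_def by auto
    next
      case False
      let ?i = "2 + (col x * q + idx x)"
      have "Suc (col x) * q \<le> q * q" using u(2)[OF x] by (intro mult_right_mono) auto
      then have "?i \<in> {1..m}" using idx_lt[OF x] unfolding m_def by simp
      moreover have "x \<in> Y ?i" using False x unfolding Y_def by simp
      ultimately show ?thesis by blast
    qed
  qed (use YP in blast)

  \<comment> \<open>Boundedness of the chain components\<close>
  have one: "scale_dim_zero ?P ?R (r 1) (Y 1)"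
  proof (rule scale_dim_zero_clustered[OF pm YP _ G(1)])
    show "r 1 > 0" using r by simp
    \<comment> \<open>Coordinates off \<open>D1\<close> cannot move at this scale, so they enter the
      label; they also determine \<open>wcol\<close>, hence which \<open>G k\<close> is in
      use.\<close>
    show "clustered ?R (ennreal (2 * r 1)) GB (Y 1) (\<lambda>x. (g (wcol x) x, restrict x (D - D1)))"
      unfolding clustered_def
    proof (intro ballI conjI impI)
      fix x y assume xy: "x \<in> Y 1" "y \<in> Y 1"
      then have P: "x \<in> ?P" "y \<in> ?P" and G': "x \<in> G (wcol x)" "y \<in> G (wcol y)"
        unfolding Y_def by auto
      have lt: "wcol x < N + q" using w(2)[OF P(1)] by simp
      have weq: "wcol x = wcol y" if "\<And>d. d \<in> D - D1 \<Longrightarrow> x d = y d"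
        using that W by (intro w(4)) auto
      { assume le: "?R x y \<le> ennreal (2 * r 1)"
        have ag: "x d = y d" if "d \<in> D - D1" for d
          using agree[OF P le] that unfolding D1_def by blast
        have "\<sigma> D1 x y \<le> ennreal (2 * r 1)" using \<sigma>_le[OF D1] le order_trans by blast
        then have "g (wcol x) x = g (wcol x) y"
          using G' weq[OF ag] by (intro clusteredD(1)[OF G(2)[OF lt]]) auto
        then show "(g (wcol x) x, restrict x (D - D1)) = (g (wcol y) y, restrict y (D - D1))"
          using weq[OF ag] ag by (auto simp: restrict_def) }
      { assume eq: "(g (wcol x) x, restrict x (D - D1)) = (g (wcol y) y, restrict y (D - D1))"
        have ag: "x d = y d" if "d \<in> D - D1" for d
        proof -
          have "restrict x (D - D1) d = restrict y (D - D1) d" using eq by simp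
          then show ?thesis using that by simp
        qed
        have "?R x y = \<sigma> D1 x y" by (rule R_eq[OF P D1 ag])
        also have "\<dots> \<le> GB"
          using eq G' weq[OF ag] by (intro clusteredD(2)[OF G(2)[OF lt]]) auto
        finally show "?R x y \<le> GB" . }
    qed
  qed
  have two: "scale_dim_zero ?P ?R (r i) (Y i)" if i: "i \<in> {1..m}" "i \<noteq> 1" for i
  proof (rule scale_dim_zero_clustered[OF pm YP])
    show "r i > 0" using r i by simp
    show "B + WB < top" using u(1) w(1) by simp
    \<comment> \<open>From \<open>x \<notin> G (wcol x)\<close> it follows that
      \<open>wcol x\<close> is in \<open>J x\<close>, with \<open>x\<close> as witness. The same
      member gives the same \<open>J\<close>, and equal ranks in it give equal colours.\<close>
    have key: "wcol x = wcol y"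
      if "x \<in> Y i" "y \<in> Y i" "f x = f y" "col x = col y" for x y
    proof -
      have P: "x \<in> ?P" "y \<in> ?P" and nG: "x \<notin> G (wcol x)" "y \<notin> G (wcol y)"
        using that i unfolding Y_def by auto
      have Jeq: "J x = J y" using that unfolding J_def by simp
      have "idx x = idx y" using that i unfolding Y_def by auto
      then have "card {k \<in> J x. k < wcol x} = card {k \<in> J x. k < wcol y}"
        unfolding idx_def Jeq .
      moreover have "wcol z \<in> J z" if "z \<in> ?P" "z \<notin> G (wcol z)" for z
        using w(2)[OF that(1)] that unfolding J_def by (simp add: bexI[of _ z])
      from this[OF P(1) nG(1)] this[OF P(2) nG(2)]
      have "wcol x \<in> J x" "wcol y \<in> J x" unfolding Jeq by auto
      ultimately show ?thesis using card_below_inj[OF finJ] by blast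
    qed
    \<comment> \<open>The common scale \<open>s\<close> dominates every \<open>2 * r i\<close>.
      \<open>key\<close> must precede the use of \<open>wf\<close>, whose labels are meaningful only
      among points of equal \<open>wcol\<close>.\<close>
    have "clustered ?R (ennreal s) (B + WB) (Y i) (\<lambda>x. (f x, wf x, restrict x (D - V s)))"
      unfolding clustered_def
    proof (intro ballI conjI impI)
      fix x y assume xy: "x \<in> Y i" "y \<in> Y i"
      then have P: "x \<in> ?P" "y \<in> ?P" and e: "col x * q + idx x = col y * q + idx y"
        using i unfolding Y_def by auto
      have "(col x * q + idx x) div q = col x" "(col y * q + idx y) div q = col y"
        using idx_lt[OF P(1)] idx_lt[OF P(2)] by auto
      then have ceq: "col x = col y" using e by simp
      { assume le: "?R x y \<le> ennreal s"
        have ag: "x d = y d" if "d \<in> D - V s" for d using agree[OF P le that] .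
        have "\<sigma> D1 x y \<le> ennreal s" using \<sigma>_le[OF D1] le order_trans by blast
        then have feq: "f x = f y"
          using P ceq by (intro clusteredD(1)[OF u(3)[of "col x"]]) auto
        have "\<sigma> W x y \<le> ennreal s" using \<sigma>_le[OF W(1,2)] le order_trans by blast
        then have "wf x = wf y"
          using P key[OF xy feq ceq] by (intro clusteredD(1)[OF w(3)[of "wcol x"]]) auto
        with feq ag show "(f x, wf x, restrict x (D - V s)) = (f y, wf y, restrict y (D - V s))"
          by (auto simp: restrict_def) }
      { assume eq: "(f x, wf x, restrict x (D - V s)) = (f y, wf y, restrict y (D - V s))"
        have ag: "x d = y d" if "d \<in> D - V s" for d
        proof -
          have "restrict x (D - V s) d = restrict y (D - V s) d" using eq by simp
          then show ?thesis using that by simp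
        qed
        have "?R x y = \<sigma> (V s) x y" by (rule R_eq[OF P finV VD ag])
        also have "\<dots> = \<sigma> D1 x y + \<sigma> W x y"
          unfolding D1W[symmetric] \<sigma>_def using D1 W by (intro sum.union_disjoint) auto
        also have "\<dots> \<le> B + WB"
        proof (rule add_mono)
          show "\<sigma> D1 x y \<le> B"
            using P ceq eq by (intro clusteredD(2)[OF u(3)[of "col x"]]) auto
          show "\<sigma> W x y \<le> WB"
            using P key[OF xy _ ceq] eq by (intro clusteredD(2)[OF w(3)[of "wcol x"]]) auto
        qed
        finally show "?R x y \<le> B + WB" . }
    qed
    then show "clustered ?R (ennreal (2 * r i)) (B + WB) (Y i) (\<lambda>x. (f x, wf x, restrict x (D - V s)))"
      by (rule clustered_mono) (use s[OF i(1)] in \<open>auto intro: ennreal_leI\<close>)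
  qed
  have "scale_dim_zero ?P ?R (r i) (Y i)" if "i \<in> {1..m}" for i
    using one two[OF that] by (cases "i = 1") simp_all
  with cover show "\<exists>n. \<exists>Y :: nat \<Rightarrow> ('d \<Rightarrow> 'a) set.
           ?P = (\<Union>i\<in>{1..n}. Y i) \<and> (\<forall>i\<in>{1..n}. scale_dim_zero ?P ?R (r i) (Y i))"
    by blast
qed

end
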